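(* Let $n\ge1$ and let $\phi(t)=(x(t),y_1(t),\ldots,y_n(t))\in\mathcal{P}_{(v_0,w_1,\ldots,w_n)}$, where $x(t)=t^{v_0}$ and $y_i(t)=t^{w_i}+\sum_{j>w_i}a_{ij}t^j$ for $1\le i\le n$; put $a_{iw_i}=1$ and $w_0=v_0$. Let $(\rho,\sigma)\in\tilde{\mathcal{A}}_1$ be of the form $$\rho(t)=t\left(1+\frac{h_0(\phi(t))}{t^{v_0}}\right)^{\frac1{v_0}},\qquad \sigma(X,\underline{Y})=(X+h_0(X,\underline{Y}),Y_1+h_1(X,\underline{Y}),\ldots,Y_n+h_n(X,\underline{Y})),$$ where $h_k\in\langle Y_{k+1},\ldots,Y_n\rangle+\mathcal{M}_{n+1}^2$ and $\mathrm{ord}_t(h_k(\phi(t)))>w_k$ for $0\le k\le n$. Then $$(\sigma\circ\phi\circ\rho^{-1})(t)=\phi(t)+\left(0,\theta_1(\rho^{-1}(t)),\ldots,\theta_n(\rho^{-1}(t))\right),$$ where $$\theta_i(t)=h_i(\phi(t))-\frac{h_0(\phi(t))\,y_i'(t)}{x'(t)}-\sum_{j\ge w_i}a_{ij}t^j\sum_{l=2}^{\infty}\binom{j/v_0}{l}\left(\frac{h_0(\phi(t))}{t^{v_0}}\right)^l .$$ Moreover, the initial term (nonzero term of lowest order) of $\theta_i(\rho^{-1}(t))$ coincides with that of $\theta_i(t)$.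
   Context: $\underline{Y}=(Y_1,\ldots,Y_n)$, and $\mathcal{M}_{n+1}=\langle X,Y_1,\ldots,Y_n\rangle$ is the maximal ideal of $\mathbb{C}\{X,\underline{Y}\}$ (convergent power series). The $v_0$-th root is the branch with $\rho'(0)=1$, and $\binom{r}{l}=r(r-1)\cdots(r-l+1)/l!$. $\mathcal{A}=\mathrm{Diff}(\mathbb{C},0)\times\mathrm{Diff}(\mathbb{C}^{n+1},0)$ (germs of analytic diffeomorphisms). $\tilde{\mathcal{A}}_1\subset\mathcal{A}$ is the subgroup of pairs $(\rho,\sigma)$ with $j^1\rho(t)=t$ and Jacobian matrix of $\sigma$ at the origin unipotent upper triangular. A parametrization is an analytic map-germ $\phi=(p_0,\ldots,p_n):(\mathbb{C},0)\to(\mathbb{C}^{n+1},0)$, always assumed primitive (not of the form $\psi(\tau(t))$ with $\mathrm{ord}_t\,\tau\ge2$) and non-degenerate (no $\sigma\circ\phi\circ\rho^{-1}$ with $(\rho,\sigma)\in\mathcal{A}$ has an identically zero component). Its value semigroup is $\Gamma=\{\mathrm{ord}_t(g(\phi(t))) : g\in\mathbb{C}\{X,\underline{Y}\},\ g(\phi(t))\neq 0\}$, and for $1\le i\le n$, $\Gamma_i=\{\mathrm{ord}_t(h(p_0,\ldots,p_{i-1})) : h\in\mathbb{C}\{X,Y_1,\ldots,Y_{i-1}\},\ h(p_0,\ldots,p_{i-1})\ne 0\}$. $\mathcal{P}_{(v_0,w_1,\ldots,w_n)}$ is the set of parametrizations $\phi(t)=(t^{v_0},y_1(t),\ldots,y_n(t))$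 such that $y_i(t)=t^{w_i}+(\text{terms of order}>w_i)$ and $w_i=\min(\Gamma\setminus\Gamma_i)$ for $1\le i\le n$, with $v_0=w_0<w_1<\cdots<w_n$ and $v_0=\min(\Gamma\setminus\{0\})$. *)

theory Defs
  imports
    "HOL-Library.Poly_Mapping"
    "HOL-Library.Extended_Nat"
    "HOL-Analysis.FPS_Convergence"
    "HOL-Analysis.Infinite_Sum"
    "HOL-Algebra.Ideal_Product"
begin

unbundle no vec_syntax
unbundle fps_syntax

section \<open>Power series in several variables\<close>

text \<open>
  A power series in the variables \<open>Z\<^sub>0, Z\<^sub>1, \<dots>\<close> is the family of its coefficients, indexed by the
  exponents \<open>\<alpha> :: nat \<Rightarrow>\<^sub>0 nat\<close>. Throughout, \<open>Z\<^sub>0\<close> is \<open>X\<close> and \<open>Z\<^sub>i\<close> is \<open>Y\<^sub>i\<close> for \<open>i \<ge> 1\<close>; the restriction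
  to finitely many variables is part of the definition of convergent series below.
\<close>

typedef 'a mfps = "UNIV :: ((nat \<Rightarrow>\<^sub>0 nat) \<Rightarrow> 'a) set"
  morphisms mcoeff Abs_mfps ..

setup_lifting type_definition_mfps

lemma mfps_eqI: "(\<And>\<alpha>. mcoeff f \<alpha> = mcoeff g \<alpha>) \<Longrightarrow> f = g"
  by transfer blast

definition exp_splits :: "(nat \<Rightarrow>\<^sub>0 nat) \<Rightarrow> ((nat \<Rightarrow>\<^sub>0 nat) \<times> (nat \<Rightarrow>\<^sub>0 nat)) set" where
  "exp_splits \<alpha> = {(\<beta>, \<gamma>). \<beta> + \<gamma> = \<alpha>}"

lemma finite_exp_splits [simp]: "finite (exp_splits \<alpha>)"
proof -
  define A where "A = {\<beta>. \<exists>\<gamma>. \<beta> + \<gamma> = (\<alpha> :: nat \<Rightarrow>\<^sub>0 nat)}"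
  define K where "K = Poly_Mapping.keys \<alpha>"
  define B where "B = {..Max (Poly_Mapping.lookup \<alpha> ` K)}"
  have le: "Poly_Mapping.lookup \<beta> x \<le> Poly_Mapping.lookup \<alpha> x" if "\<beta> \<in> A" for \<beta> x
    using that by (auto simp: A_def lookup_add)
  have "Poly_Mapping.lookup \<beta> x \<in> B" if "\<beta> \<in> A" "x \<in> K" for \<beta> x
  proof -
    have "Poly_Mapping.lookup \<alpha> x \<le> Max (Poly_Mapping.lookup \<alpha> ` K)"
      using that by (intro Max_ge) (auto simp: K_def)
    then show ?thesis using le[OF that(1), of x] by (simp add: B_def)
  qed
  moreover have "Poly_Mapping.lookup \<beta> x = 0" if "\<beta> \<in> A" "x \<notin> K" for \<beta> x
    using le[of \<beta> x] that by (simp add: K_def in_keys_iff)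
  ultimately have "Poly_Mapping.lookup ` A \<subseteq>
      {f. \<forall>x. (x \<in> K \<longrightarrow> f x \<in> B) \<and> (x \<notin> K \<longrightarrow> f x = 0)}"
    by auto
  moreover have "finite {f. \<forall>x. (x \<in> K \<longrightarrow> f x \<in> B) \<and> (x \<notin> K \<longrightarrow> f x = 0)}"
    by (rule finite_set_of_finite_funs) (auto simp: K_def B_def)
  ultimately have "finite (Poly_Mapping.lookup ` A)" by (rule finite_subset)
  then have "finite A"
    by (rule finite_imageD) (auto intro!: inj_onI poly_mapping_eqI)
  moreover have "exp_splits \<alpha> \<subseteq> A \<times> A"
    by (auto simp: exp_splits_def A_def) (metis add.commute)
  ultimately show ?thesis by (meson finite_SigmaI finite_subset)
qed

instantiation mfps :: (comm_ring_1) comm_ring_1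
begin

lift_definition zero_mfps :: "'a mfps" is "\<lambda>_. 0" .
lift_definition one_mfps :: "'a mfps" is "\<lambda>\<alpha>. if \<alpha> = 0 then 1 else 0" .
lift_definition plus_mfps :: "'a mfps \<Rightarrow> 'a mfps \<Rightarrow> 'a mfps" is "\<lambda>f g \<alpha>. f \<alpha> + g \<alpha>" .
lift_definition minus_mfps :: "'a mfps \<Rightarrow> 'a mfps \<Rightarrow> 'a mfps" is "\<lambda>f g \<alpha>. f \<alpha> - g \<alpha>" .
lift_definition uminus_mfps :: "'a mfps \<Rightarrow> 'a mfps" is "\<lambda>f \<alpha>. - f \<alpha>" .
lift_definition times_mfps :: "'a mfps \<Rightarrow> 'a mfps \<Rightarrow> 'a mfps"
  is "\<lambda>f g \<alpha>. \<Sum>(\<beta>, \<gamma>)\<in>exp_splits \<alpha>. f \<beta> * g \<gamma>" .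

instance
proof
  fix a b c :: "'a mfps"
  show "a * b * c = a * (b * c)"
  proof (rule mfps_eqI)
    fix \<alpha>
    have "mcoeff (a * b * c) \<alpha> =
        (\<Sum>p\<in>exp_splits \<alpha>. \<Sum>q\<in>exp_splits (fst p).
          mcoeff a (fst q) * mcoeff b (snd q) * mcoeff c (snd p))"
      by (simp add: times_mfps.rep_eq case_prod_unfold sum_distrib_right)
    also have "\<dots> = (\<Sum>(p, q)\<in>(SIGMA p:exp_splits \<alpha>. exp_splits (fst p)).
          mcoeff a (fst q) * mcoeff b (snd q) * mcoeff c (snd p))"
      by (rule sum.Sigma) auto
    also have "\<dots> = (\<Sum>(p, q)\<in>(SIGMA p:exp_splits \<alpha>. exp_splits (snd p)).
          mcoeff a (fst p) * (mcoeff b (fst q) * mcoeff c (snd q)))"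
      by (rule sum.reindex_bij_witness
            [where j = "\<lambda>(p, q). ((fst q, snd q + snd p), (snd q, snd p))"
               and i = "\<lambda>(p, q). ((fst p + fst q, snd q), (fst p, fst q))"])
         (auto simp: exp_splits_def add.assoc mult.assoc)
    also have "\<dots> = (\<Sum>p\<in>exp_splits \<alpha>. \<Sum>q\<in>exp_splits (snd p).
          mcoeff a (fst p) * (mcoeff b (fst q) * mcoeff c (snd q)))"
      by (rule sum.Sigma [symmetric]) auto
    also have "\<dots> = mcoeff (a * (b * c)) \<alpha>"
      by (simp add: times_mfps.rep_eq case_prod_unfold sum_distrib_left)
    finally show "mcoeff (a * b * c) \<alpha> = mcoeff (a * (b * c)) \<alpha>" .
  qed
  show "a * b = b * a"
    by transfer
       (rule ext, rule sum.reindex_bij_witness[where i = prod.swap and j = prod.swap],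
        auto simp: exp_splits_def add.commute mult.commute)
  show "1 * a = a"
  proof (rule mfps_eqI)
    fix \<alpha>
    have "mcoeff (1 * a) \<alpha> =
        (\<Sum>p\<in>exp_splits \<alpha>. if p = (0, \<alpha>) then mcoeff a \<alpha> else 0)"
      unfolding times_mfps.rep_eq one_mfps.rep_eq
      by (rule sum.cong) (auto simp: exp_splits_def split: if_splits)
    also have "\<dots> = mcoeff a \<alpha>"
      by (simp add: exp_splits_def sum.delta[OF finite_exp_splits, unfolded exp_splits_def])
    finally show "mcoeff (1 * a) \<alpha> = mcoeff a \<alpha>" .
  qed
  show "(a + b) * c = a * c + b * c"
    by transfer (auto simp: fun_eq_iff case_prod_unfold distrib_right sum.distrib)
  show "a + b + c = a + (b + c)" by transfer (auto simp: add.assoc)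
  show "a + b = b + a" by transfer (auto simp: add.commute)
  show "0 + a = a" by transfer simp
  show "- a + a = 0" by transfer simp
  show "a - b = a + - b" by transfer simp
  show "(0 :: 'a mfps) \<noteq> 1" by transfer (auto simp: fun_eq_iff)
qed

end

lift_definition mvar :: "nat \<Rightarrow> 'a::comm_ring_1 mfps"
  is "\<lambda>i \<alpha>. if \<alpha> = Poly_Mapping.single i 1 then 1 else 0" .

definition mdeg :: "(nat \<Rightarrow>\<^sub>0 nat) \<Rightarrow> nat" where
  "mdeg \<alpha> = (\<Sum>i\<in>Poly_Mapping.keys \<alpha>. Poly_Mapping.lookup \<alpha> i)"

text \<open>
  Substitution of a tuple \<open>p\<^sub>0, \<dots>, p\<^bsub>m-1\<^esub>\<close> of power series without constant term into a power
  series \<open>g\<close> in \<open>m\<close> variables. As \<open>p\<^sup>\<alpha>\<close> has order at least \<open>mdeg \<alpha>\<close>, only the finitely many exponents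
  with \<open>mdeg \<alpha> \<le> k\<close> contribute to the coefficients of degree \<open>k\<close> of \<open>\<Sum>\<^sub>\<alpha> g\<^sub>\<alpha> p\<^sup>\<alpha>\<close>. In \<open>mfps_subst\<close> the
  \<open>p\<^sub>i\<close> are series in one variable \<open>t\<close>, in \<open>mfps_compose\<close> they are series in several variables.
\<close>

definition mfps_subst :: "nat \<Rightarrow> 'a::comm_ring_1 mfps \<Rightarrow> (nat \<Rightarrow> 'a fps) \<Rightarrow> 'a fps" where
  "mfps_subst m g p = Abs_fps (\<lambda>k.
     \<Sum>\<alpha> | Poly_Mapping.keys \<alpha> \<subseteq> {..<m} \<and> mdeg \<alpha> \<le> k.
       mcoeff g \<alpha> * (\<Prod>i<m. p i ^ Poly_Mapping.lookup \<alpha> i) $ k)"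

definition mfps_compose :: "nat \<Rightarrow> 'a::comm_ring_1 mfps \<Rightarrow> (nat \<Rightarrow> 'a mfps) \<Rightarrow> 'a mfps" where
  "mfps_compose m g p = Abs_mfps (\<lambda>\<beta>.
     \<Sum>\<alpha> | Poly_Mapping.keys \<alpha> \<subseteq> {..<m} \<and> mdeg \<alpha> \<le> mdeg \<beta>.
       mcoeff g \<alpha> * mcoeff (\<Prod>i<m. p i ^ Poly_Mapping.lookup \<alpha> i) \<beta>)"

section \<open>Convergent power series and their ideals\<close>

definition conv_series :: "nat \<Rightarrow> complex mfps set" where
  "conv_series m = {f. (\<forall>\<alpha>. mcoeff f \<alpha> \<noteq> 0 \<longrightarrow> Poly_Mapping.keys \<alpha> \<subseteq> {..<m}) \<and>
     (\<exists>r>0. (\<lambda>\<alpha>. norm (mcoeff f \<alpha>) * r ^ mdeg \<alpha>) summable_on UNIV)}"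

definition conv_ring :: "nat \<Rightarrow> complex mfps ring" where
  "conv_ring m = \<lparr>carrier = conv_series m, mult = (*), one = 1, zero = 0, add = (+)\<rparr>"

definition conv_max_ideal :: "nat \<Rightarrow> complex mfps set" where
  "conv_max_ideal m = Idl\<^bsub>conv_ring m\<^esub> (mvar ` {..<m})"

section \<open>Germs of analytic maps and diffeomorphisms\<close>

text \<open>Analytic map-germs at the origin are represented by their (convergent) Taylor series.\<close>

definition curve_germ :: "complex fps \<Rightarrow> bool" where
  "curve_germ f \<longleftrightarrow> fps_conv_radius f > 0 \<and> f $ 0 = 0"

definition diff1 :: "complex fps set" where
  "diff1 = {\<rho>. curve_germ \<rho> \<and> (\<exists>\<tau>. curve_germ \<tau> \<and> \<rho> oo \<tau> = fps_X \<and> \<tau> oo \<rho> = fps_X)}"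

definition map_germs :: "nat \<Rightarrow> (nat \<Rightarrow> complex mfps) set" where
  "map_germs m = {\<sigma>. \<forall>i<m. \<sigma> i \<in> conv_series m \<and> mcoeff (\<sigma> i) 0 = 0}"

definition diffs :: "nat \<Rightarrow> (nat \<Rightarrow> complex mfps) set" where
  "diffs m = {\<sigma> \<in> map_germs m. \<exists>\<tau>\<in>map_germs m.
     \<forall>i<m. mfps_compose m (\<sigma> i) \<tau> = mvar i \<and> mfps_compose m (\<tau> i) \<sigma> = mvar i}"

definition A_group :: "nat \<Rightarrow> (complex fps \<times> (nat \<Rightarrow> complex mfps)) set" where
  "A_group n = diff1 \<times> diffs (n + 1)"

text \<open>The map-germ \<open>\<sigma> \<circ> \<phi> \<circ> \<rho>\<^sup>-\<^sup>1\<close>, whose components are indexed by \<open>0, \<dots>, n\<close>.\<close>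

definition A_act :: "nat \<Rightarrow> complex fps \<Rightarrow> (nat \<Rightarrow> complex mfps) \<Rightarrow> (nat \<Rightarrow> complex fps) \<Rightarrow>
    nat \<Rightarrow> complex fps" where
  "A_act n \<rho> \<sigma> \<phi> = (\<lambda>i. mfps_subst (n + 1) (\<sigma> i) \<phi> oo fps_inv \<rho>)"

text \<open>The entry \<open>(k, l)\<close> of the Jacobian matrix at the origin is a coefficient of degree one.\<close>

definition jacobian0 :: "(nat \<Rightarrow> complex mfps) \<Rightarrow> nat \<Rightarrow> nat \<Rightarrow> complex" where
  "jacobian0 \<sigma> k l = mcoeff (\<sigma> k) (Poly_Mapping.single l 1)"

definition A1_tilde :: "nat \<Rightarrow> (complex fps \<times> (nat \<Rightarrow> complex mfps)) set" where
  "A1_tilde n = {(\<rho>, \<sigma>) \<in> A_group n. \<rho> $ 0 = 0 \<and> \<rho> $ 1 = 1 \<and>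
     (\<forall>k\<le>n. jacobian0 \<sigma> k k = 1) \<and> (\<forall>k\<le>n. \<forall>l<k. jacobian0 \<sigma> k l = 0)}"

section \<open>Parametrizations\<close>

definition fps_ord :: "complex fps \<Rightarrow> enat" where
  "fps_ord f = (if f = 0 then \<infinity> else enat (subdegree f))"

definition fps_initial_term :: "complex fps \<Rightarrow> complex fps" where
  "fps_initial_term f = fps_const (f $ subdegree f) * fps_X ^ subdegree f"

definition primitive :: "nat \<Rightarrow> (nat \<Rightarrow> complex fps) \<Rightarrow> bool" where
  "primitive n \<phi> \<longleftrightarrow> \<not> (\<exists>\<psi> \<tau>. (\<forall>i\<le>n. curve_germ (\<psi> i)) \<and> curve_germ \<tau> \<and> fps_ord \<tau> \<ge> 2 \<and>
     (\<forall>i\<le>n. \<phi> i = \<psi> i oo \<tau>))"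

definition nondegenerate :: "nat \<Rightarrow> (nat \<Rightarrow> complex fps) \<Rightarrow> bool" where
  "nondegenerate n \<phi> \<longleftrightarrow> (\<forall>(\<rho>, \<sigma>)\<in>A_group n. \<forall>i\<le>n. A_act n \<rho> \<sigma> \<phi> i \<noteq> 0)"

definition parametrization :: "nat \<Rightarrow> (nat \<Rightarrow> complex fps) \<Rightarrow> bool" where
  "parametrization n \<phi> \<longleftrightarrow> (\<forall>i\<le>n. curve_germ (\<phi> i)) \<and> primitive n \<phi> \<and> nondegenerate n \<phi>"

text \<open>
  The orders of the nonzero series \<open>g(\<phi>\<^sub>0, \<dots>, \<phi>\<^bsub>m-1\<^esub>)\<close>. For \<open>\<phi>\<close> with components \<open>0, \<dots>, n\<close> the value
  semigroup \<open>\<Gamma>\<close> is \<open>value_set (n + 1) \<phi>\<close>, and \<open>\<Gamma>\<^sub>i\<close> is \<open>value_set i \<phi>\<close>.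
\<close>

definition value_set :: "nat \<Rightarrow> (nat \<Rightarrow> complex fps) \<Rightarrow> nat set" where
  "value_set m \<phi> = {subdegree (mfps_subst m g \<phi>) | g. g \<in> conv_series m \<and> mfps_subst m g \<phi> \<noteq> 0}"

definition is_min_of :: "nat \<Rightarrow> nat set \<Rightarrow> bool" where
  "is_min_of k S \<longleftrightarrow> k \<in> S \<and> (\<forall>l\<in>S. k \<le> l)"

definition param_class :: "nat \<Rightarrow> nat \<Rightarrow> (nat \<Rightarrow> nat) \<Rightarrow> (nat \<Rightarrow> complex fps) set" where
  "param_class n v0 w = {\<phi>. parametrization n \<phi> \<and>
     \<phi> 0 = fps_X ^ v0 \<and>
     (\<forall>i\<in>{1..n}. \<phi> i $ w i = 1 \<and> (\<forall>j<w i. \<phi> i $ j = 0)) \<and>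
     (\<forall>i\<in>{1..n}. is_min_of (w i) (value_set (n + 1) \<phi> - value_set i \<phi>)) \<and>
     w 0 = v0 \<and> (\<forall>i<n. w i < w (Suc i)) \<and>
     is_min_of v0 (value_set (n + 1) \<phi> - {0})}"

end

theory Submission
  imports Defs
begin

text \<open>
  Put \<open>u = h\<^sub>0(\<phi>) / t\<^bsup>v\<^sub>0\<^esup>\<close>, so that \<open>\<rho> = t (1 + u)\<^bsup>1/v\<^sub>0\<^esup>\<close> and \<open>x \<circ> \<rho> = t\<^bsup>v\<^sub>0\<^esup> (1 + u) = x + h\<^sub>0(\<phi>)\<close>. Expanding
  \<open>\<rho>\<^sup>j = t\<^sup>j (1 + u)\<^bsup>j/v\<^sub>0\<^esup>\<close> by the binomial series, the terms of degree at most one in \<open>u\<close> add up to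
  \<open>y\<^sub>i + h\<^sub>0(\<phi>) y\<^sub>i' / x'\<close>, so the definition of \<open>\<theta>\<^sub>i\<close> says precisely that \<open>y\<^sub>i \<circ> \<rho> = y\<^sub>i + h\<^sub>i(\<phi>) - \<theta>\<^sub>i\<close>.
  It remains to compose with \<open>\<rho>\<inverse>\<close>, which is tangent to the identity and hence preserves initial
  terms.
\<close>

lemma mdeg_single [simp]: "mdeg (Poly_Mapping.single i c) = c"
  by (simp add: mdeg_def)

lemma lookup_le_mdeg: "Poly_Mapping.lookup \<alpha> i \<le> mdeg \<alpha>"
proof (cases "i \<in> Poly_Mapping.keys \<alpha>")
  case True
  then show ?thesis unfolding mdeg_def by (intro member_le_sum) auto
qed (simp add: in_keys_iff)

text \<open>The total degree bounds every entry of \<alpha>, and there are only m entries.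
  Finiteness matters because a sum over an infinite set is 0 by convention, and
  \<open>sum.delta\<close> is applied to this index set below.\<close>

lemma finite_exponents: "finite {\<alpha>. Poly_Mapping.keys \<alpha> \<subseteq> {..<m} \<and> mdeg \<alpha> \<le> k}" (is "finite ?S")
proof -
  have "Poly_Mapping.lookup ` ?S \<subseteq>
      {f. \<forall>x. (x \<in> {..<m} \<longrightarrow> f x \<in> {..k}) \<and> (x \<notin> {..<m} \<longrightarrow> f x = 0)}"
    by (auto simp: subset_iff in_keys_iff intro: order_trans[OF lookup_le_mdeg])
  then have "finite (Poly_Mapping.lookup ` ?S)"
    by (rule finite_subset) (rule finite_set_of_finite_funs, auto)
  then show ?thesis
    by (rule finite_imageD) (auto intro!: inj_onI poly_mapping_eqI)
qed

lemma mfps_subst_add: "mfps_subst m (f + g) p = mfps_subst m f p + mfps_subst m g p"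
  by (simp add: fps_eq_iff mfps_subst_def plus_mfps.rep_eq distrib_right sum.distrib)

lemma mfps_subst_mvar:
  assumes "i < m" and "p i $ 0 = 0"
  shows "mfps_subst m (mvar i) p = p i"
proof (rule fps_ext)
  fix k
  let ?S = "{\<alpha>. Poly_Mapping.keys \<alpha> \<subseteq> {..<m} \<and> mdeg \<alpha> \<le> k}"
  let ?e = "Poly_Mapping.single i (1::nat)"
  have prod: "(\<Prod>j<m. p j ^ Poly_Mapping.lookup ?e j) = p i"
  proof -
    have "(\<Prod>j<m. p j ^ Poly_Mapping.lookup ?e j) = (\<Prod>j<m. if j = i then p j else 1)"
      by (rule prod.cong) (auto simp: lookup_single when_def)
    then show ?thesis using \<open>i < m\<close> by simp
  qed
  have "mfps_subst m (mvar i) p $ k =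
      (\<Sum>\<alpha>\<in>?S. if \<alpha> = ?e then (\<Prod>j<m. p j ^ Poly_Mapping.lookup \<alpha> j) $ k else 0)"
    unfolding mfps_subst_def mvar.rep_eq by (simp add: if_distrib if_distribR cong: if_cong)
  also have "\<dots> = (if ?e \<in> ?S then (\<Prod>j<m. p j ^ Poly_Mapping.lookup ?e j) $ k else 0)"
    by (rule sum.delta) (rule finite_exponents)
  \<comment> \<open>For k = 0 the exponent \<open>?e\<close> has degree 1 and lies outside
    \<open>?S\<close>; the resulting 0 agrees with the vanishing constant term of
    \<open>p i\<close>.\<close>
  also have "\<dots> = p i $ k"
    unfolding prod using assms by (cases k) auto
  finally show "mfps_subst m (mvar i) p $ k = p i $ k" .
qed

text \<open>Convergence of formal power series is coefficientwise stabilisation: the terms with j >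
  n do not reach coefficient n, so the partial sums become constant there.\<close>

lemma suminf_shift_fps_nth:
  fixes f :: "nat \<Rightarrow> 'a::comm_ring_1 fps"
  assumes "\<And>j n. n < j \<Longrightarrow> f j $ n = 0"
  shows "suminf (\<lambda>j. f (j + k)) $ n = (\<Sum>j=k..n. f j $ n)"
proof -
  have "(\<lambda>j. f (j + k)) sums Abs_fps (\<lambda>n. \<Sum>j=k..n. f j $ n)"
    unfolding sums_def
  proof (rule tendsto_fpsI)
    fix n
    have "(\<Sum>j<N. f (j + k)) $ n = (\<Sum>j=k..n. f j $ n)" if "N > n" for N
    proof -
      have "(\<Sum>j<N. f (j + k)) $ n = (\<Sum>j\<in>{k..<N+k}. f j $ n)"
        using sum.shift_bounds_nat_ivl[of "\<lambda>j. f j $ n" 0 k N]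
        by (simp add: fps_sum_nth atLeast0LessThan)
      also have "\<dots> = (\<Sum>j=k..n. f j $ n)"
        using that assms by (intro sum.mono_neutral_right) auto
      finally show ?thesis .
    qed
    then show "eventually (\<lambda>N. (\<Sum>j<N. f (j + k)) $ n = Abs_fps (\<lambda>n. \<Sum>j=k..n. f j $ n) $ n)
        sequentially"
      by (auto intro: eventually_sequentiallyI[of "Suc n"])
  qed
  then show ?thesis by (simp add: sums_unique [symmetric])
qed

lemma suminf_tail_fps_compose:
  fixes f u :: "'a::comm_ring_1 fps"
  assumes "u $ 0 = 0"
  shows "suminf (\<lambda>l. fps_const (f $ (l + 2)) * u ^ (l + 2)) =
      (f oo u) - fps_const (f $ 0) - fps_const (f $ 1) * u"
proof (rule fps_ext)
  fix n
  let ?g = "\<lambda>l. fps_const (f $ l) * u ^ l"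
  have g: "?g l $ n = 0" if "n < l" for l n
    using startsby_zero_power_prefix[OF assms, of l] that by simp
  have "(f oo u) $ n = (\<Sum>l\<le>n. ?g l $ n)"
    by (simp add: fps_compose_nth atLeast0AtMost)
  \<comment> \<open>For n = 0 the index 1 is not in \<open>{..n}\<close>; the extra term is harmless
    by \<open>g\<close>.\<close>
  also have "\<dots> = (\<Sum>l\<in>{0,1} \<union> {2..n}. ?g l $ n)"
    using g by (intro sum.mono_neutral_left) auto
  also have "\<dots> = ?g 0 $ n + ?g 1 $ n + (\<Sum>l=2..n. ?g l $ n)"
    by (subst sum.union_disjoint) auto
  finally show "suminf (\<lambda>l. ?g (l + 2)) $ n =
      ((f oo u) - fps_const (f $ 0) - fps_const (f $ 1) * u) $ n"
    using suminf_shift_fps_nth[of ?g 2 n, OF g] by simp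
qed

text \<open>To be applied with f = y_i. The parts (j/v) t^j u that are linear in u, weighted by the
  coefficients of f, sum to (u/v) t f'. The shift of j by w gives the double series the literal
  shape it has in \<theta>.\<close>

lemma fps_compose_X_times_binomial:
  fixes f u :: "'a::field_char_0 fps"
  assumes u: "u $ 0 = 0" and f: "\<And>j. j < w \<Longrightarrow> f $ j = 0"
  shows "f oo (fps_X * (fps_binomial (1 / of_nat v) oo u)) =
      f + fps_const (1 / of_nat v) * (u * (fps_X * fps_deriv f)) +
      suminf (\<lambda>j. fps_const (f $ (j + w)) * fps_X ^ (j + w) *
        suminf (\<lambda>l. fps_const ((of_nat (j + w) / of_nat v) gchoose (l + 2)) * u ^ (l + 2)))"
    (is "f oo ?\<rho> = _")
proof (rule fps_ext)
  fix n
  define V where "V j = suminf (\<lambda>l. fps_const ((of_nat j / of_nat v :: 'a) gchoose (l + 2)) * u ^ (l + 2))"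
    for j :: nat
  have V: "V j = (fps_binomial (of_nat j / of_nat v) oo u) - 1 - fps_const (of_nat j / of_nat v) * u" for j
    unfolding V_def using suminf_tail_fps_compose[OF u, of "fps_binomial (of_nat j / of_nat v)"] by simp
  \<comment> \<open>The j-th power of (1 + u)^(1/v) is (1 + u)^(j/v), and \<open>V j\<close> is its
    remainder from u^2 on.\<close>
  have pow: "?\<rho> ^ j = fps_X ^ j + fps_const (of_nat j / of_nat v) * (fps_X ^ j * u) + fps_X ^ j * V j" for j
    by (simp add: V power_mult_distrib fps_compose_power[OF u] fps_binomial_power algebra_simps)
  let ?g = "\<lambda>j. fps_const (f $ j) * fps_X ^ j * V j"
  have g: "?g j $ n = 0" if "n < j" for j n
    using that by (simp add: mult.assoc fps_X_power_mult_nth)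
  have "(f oo ?\<rho>) $ n = (\<Sum>j=0..n. (fps_const (f $ j) * fps_X ^ j) $ n)
      + (\<Sum>j=0..n. (fps_const (f $ j * (of_nat j / of_nat v)) * (fps_X ^ j * u)) $ n)
      + (\<Sum>j=0..n. ?g j $ n)"
    unfolding fps_compose_nth pow by (simp add: mult.assoc distrib_left sum.distrib)
  also have "(\<Sum>j=0..n. (fps_const (f $ j) * fps_X ^ j) $ n) = f $ n"
    by (simp add: mult_delta_right)
  also have "(\<Sum>j=0..n. (fps_const (f $ j * (of_nat j / of_nat v)) * (fps_X ^ j * u)) $ n) =
      (fps_const (1 / of_nat v) * (u * (fps_X * fps_deriv f))) $ n"
  proof -
    \<comment> \<open>The Euler operator t d/dt multiplies the coefficient of t^j by j, which is the
      numerator of j/v.\<close>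
    have X: "(fps_X * fps_deriv f) $ j = of_nat j * f $ j" for j
      by (cases j) simp_all
    have "(u * (fps_X * fps_deriv f)) $ n = (\<Sum>j=0..n. of_nat j * f $ j * u $ (n - j))"
      by (subst mult.commute) (simp only: fps_mult_nth[of "fps_X * fps_deriv f"] X)
    then show ?thesis
      unfolding fps_mult_left_const_nth sum_distrib_left
      by (simp only: sum_distrib_left) (rule sum.cong, simp_all add: fps_X_power_mult_nth)
  qed
  also have "(\<Sum>j=0..n. ?g j $ n) = (\<Sum>j=w..n. ?g j $ n)"
    using f by (intro sum.mono_neutral_right) auto
  also have "\<dots> = suminf (\<lambda>j. ?g (j + w)) $ n"
    using suminf_shift_fps_nth[of ?g w n, OF g] by simp
  finally show "(f oo ?\<rho>) $ n = (f + fps_const (1 / of_nat v) * (u * (fps_X * fps_deriv f)) +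
      suminf (\<lambda>j. fps_const (f $ (j + w)) * fps_X ^ (j + w) *
        suminf (\<lambda>l. fps_const ((of_nat (j + w) / of_nat v) gchoose (l + 2)) * u ^ (l + 2)))) $ n"
    by (simp add: V_def)
qed

text \<open>Both sides are v-th roots of 1 + u with constant term 1, and such a root is unique. The
  selector \<open>\<lambda>_ _. 1\<close> fixes this constant term, hence the branch with derivative
  1 at the origin.\<close>

lemma fps_radical_one_plus:
  fixes u :: "'a::field_char_0 fps"
  assumes "v > 0" and "u $ 0 = 0"
  shows "fps_radical (\<lambda>_ _. 1) v (1 + u) = fps_binomial (1 / of_nat v) oo u"
proof -
  obtain k where k: "v = Suc k" using \<open>v > 0\<close> by (cases v) auto
  have "(fps_binomial (1 / of_nat v) oo u) ^ v = 1 + u"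
    using assms by (simp add: fps_compose_power fps_binomial_power fps_binomial_1
        fps_compose_add_distrib fps_X_fps_compose_startby0)
  then show ?thesis
    using assms(2) radical_unique[of "\<lambda>_ _. 1" k "1 + u" "fps_binomial (1 / of_nat v) oo u"]
    by (simp add: k)
qed

text \<open>Since \<tau> = t + higher terms, each power \<tau>^i is t^i + higher terms. At the order
  d of f, terms with i < d vanish through f, so only the leading term of \<tau>^d
  contributes.\<close>

lemma fps_initial_term_compose:
  assumes "\<tau> $ 0 = 0" and "\<tau> $ 1 = 1"
  shows "fps_initial_term (f oo \<tau>) = fps_initial_term f"
proof -
  have "subdegree \<tau> = 1"
    using assms by (intro subdegreeI) auto
  then have d: "subdegree (f oo \<tau>) = subdegree f"
    using assms by simp
  have "(f oo \<tau>) $ subdegree f = (\<Sum>i\<in>{subdegree f}. f $ i * \<tau> ^ i $ subdegree f)"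
    unfolding fps_compose_nth
    by (intro sum.mono_neutral_right) (auto intro: nth_less_subdegree_zero)
  then have "(f oo \<tau>) $ subdegree f = f $ subdegree f"
    using assms by (simp add: startsby_zero_power_nth_same)
  with d show ?thesis by (simp add: fps_initial_term_def)
qed

theorem proposition4p5:
  fixes n v0 :: nat and w :: "nat \<Rightarrow> nat"
    and \<phi> \<theta> :: "nat \<Rightarrow> complex fps" and a :: "nat \<Rightarrow> nat \<Rightarrow> complex"
    and \<rho> :: "complex fps" and \<sigma> h :: "nat \<Rightarrow> complex mfps"
  assumes n: "n \<ge> 1"
    and \<phi>: "\<phi> \<in> param_class n v0 w"
    and a: "\<And>i j. 1 \<le> i \<Longrightarrow> i \<le> n \<Longrightarrow> j \<ge> w i \<Longrightarrow> a i j = \<phi> i $ j"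
    and A1: "(\<rho>, \<sigma>) \<in> A1_tilde n"
    and \<rho>: "\<rho> = fps_X * fps_radical (\<lambda>_ _. 1) v0
                        (1 + mfps_subst (n + 1) (h 0) \<phi> / fps_X ^ v0)"
    and \<sigma>: "\<And>k. k \<le> n \<Longrightarrow> \<sigma> k = mvar k + h k"
    and h_ideal: "\<And>k. k \<le> n \<Longrightarrow>
          h k \<in> (Idl\<^bsub>conv_ring (n + 1)\<^esub> (mvar ` {k+1..n}))
                 <+>\<^bsub>conv_ring (n + 1)\<^esub>
                (conv_max_ideal (n + 1) \<cdot>\<^bsub>conv_ring (n + 1)\<^esub> conv_max_ideal (n + 1))"
    and h_ord: "\<And>k. k \<le> n \<Longrightarrow> fps_ord (mfps_subst (n + 1) (h k) \<phi>) > enat (w k)"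
    and \<theta>: "\<And>i. 1 \<le> i \<Longrightarrow> i \<le> n \<Longrightarrow>
          \<theta> i = mfps_subst (n + 1) (h i) \<phi>
              - mfps_subst (n + 1) (h 0) \<phi> * fps_deriv (\<phi> i) / fps_deriv (\<phi> 0)
              - suminf (\<lambda>j. fps_const (a i (j + w i)) * fps_X ^ (j + w i) *
                   suminf (\<lambda>l. fps_const ((of_nat (j + w i) / of_nat v0) gchoose (l + 2)) *
                        (mfps_subst (n + 1) (h 0) \<phi> / fps_X ^ v0) ^ (l + 2)))"
  shows "(\<forall>i\<le>n. A_act n \<rho> \<sigma> \<phi> i = \<phi> i + (if i = 0 then 0 else \<theta> i oo fps_inv \<rho>)) \<and>
         (\<forall>i\<in>{1..n}. fps_initial_term (\<theta> i oo fps_inv \<rho>) = fps_initial_term (\<theta> i))"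
proof -
  define H where "H k = mfps_subst (n + 1) (h k) \<phi>" for k
  define u where "u = H 0 / fps_X ^ v0"
  have germ: "\<phi> i $ 0 = 0" if "i \<le> n" for i
    using \<phi> that by (auto simp: param_class_def parametrization_def curve_germ_def)
  have \<phi>0: "\<phi> 0 = fps_X ^ v0" and w0: "w 0 = v0" and v0: "v0 > 0"
    using \<phi> by (auto simp: param_class_def is_min_of_def)
  have below: "\<phi> i $ j = 0" if "1 \<le> i" "i \<le> n" "j < w i" for i j
    using \<phi> that by (auto simp: param_class_def)
  \<comment> \<open>The order bound for k = 0 has two uses: it makes the division by
    \<open>fps_X ^ v0\<close> exact, and its strictness gives u constant term 0, so that series can
    be composed with u.\<close>
  have ord: "H 0 = 0 \<or> v0 < subdegree (H 0)"
    using h_ord[of 0] by (auto simp: H_def fps_ord_def w0 split: if_splits)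
  have H0: "H 0 = u * fps_X ^ v0"
    using ord by (auto simp: u_def fps_shift_times_fps_X_power)
  have u0: "u $ 0 = 0"
    using ord by (auto simp: u_def)
  have \<rho>_eq: "\<rho> = fps_X * (fps_binomial (1 / of_nat v0) oo u)"
    using \<rho> fps_radical_one_plus[OF v0 u0] by (simp add: u_def H_def)
  have \<rho>0: "\<rho> $ 0 = 0" and \<rho>1: "\<rho> $ 1 = 1"
    by (simp_all add: \<rho>_eq)
  have inv0: "fps_inv \<rho> $ 0 = 0" and inv1: "fps_inv \<rho> $ 1 = 1"
    using \<rho>1 by (simp_all add: fps_inv_def)
  have \<sigma>\<phi>: "mfps_subst (n + 1) (\<sigma> i) \<phi> = \<phi> i + H i" if "i \<le> n" for i
    using that germ[OF that] by (simp add: \<sigma> mfps_subst_add mfps_subst_mvar H_def)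
  have cancel: "(f oo \<rho>) oo fps_inv \<rho> = f" for f
    using fps_inv_right[OF \<rho>0] \<rho>1 by (simp flip: fps_compose_assoc[OF inv0 \<rho>0])
  have \<phi>0\<rho>: "\<phi> 0 oo \<rho> = \<phi> 0 + H 0"
  proof -
    have "\<phi> 0 oo \<rho> = \<rho> ^ v0"
      by (simp add: \<phi>0 fps_X_fps_compose_startby0 \<rho>0 flip: fps_compose_power[OF \<rho>0])
    also have "\<dots> = fps_X ^ v0 * (1 + u)"
      using v0 by (simp add: \<rho>_eq power_mult_distrib fps_compose_power[OF u0] fps_binomial_power
          fps_binomial_1 fps_compose_add_distrib fps_X_fps_compose_startby0 u0)
    finally show ?thesis by (simp add: \<phi>0 H0 algebra_simps)
  qed
  \<comment> \<open>Here x' = v0 t^(v0-1) and \<open>H 0\<close> = u t^v0. As \<open>/\<close> on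
    series is not a field division, the product form is proved first and the nonzero factor x' is
    then cancelled.\<close>
  have quot: "H 0 * fps_deriv f / fps_deriv (\<phi> 0) =
      fps_const (1 / of_nat v0) * (u * (fps_X * fps_deriv f))" for f
  proof -
    have "fps_X ^ v0 = fps_X * (fps_X :: complex fps) ^ (v0 - 1)"
      using v0 by (simp flip: power_Suc)
    then have "H 0 * fps_deriv f =
        fps_const (1 / of_nat v0) * (u * (fps_X * fps_deriv f)) * fps_deriv (\<phi> 0)"
      using v0 by (simp add: H0 \<phi>0 fps_deriv_power fps_of_nat[symmetric] mult_ac)
    moreover have "fps_deriv (\<phi> 0) \<noteq> 0"
      using v0 by (simp add: \<phi>0 fps_deriv_power)
    ultimately show ?thesis by (simp only: nonzero_mult_div_cancel_right not_False_eq_True)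
  qed
  have \<phi>\<rho>: "\<phi> i oo \<rho> = \<phi> i + H i - \<theta> i" if i: "1 \<le> i" "i \<le> n" for i
  proof -
    let ?S = "suminf (\<lambda>j. fps_const (\<phi> i $ (j + w i)) * fps_X ^ (j + w i) *
        suminf (\<lambda>l. fps_const ((of_nat (j + w i) / of_nat v0) gchoose (l + 2)) * u ^ (l + 2)))"
    have "a i (j + w i) = \<phi> i $ (j + w i)" for j
      using a[OF i] by simp
    then have "\<theta> i = H i - H 0 * fps_deriv (\<phi> i) / fps_deriv (\<phi> 0) - ?S"
      using \<theta>[OF i] by (simp only: H_def u_def)
    moreover have "\<phi> i oo \<rho> = \<phi> i + H 0 * fps_deriv (\<phi> i) / fps_deriv (\<phi> 0) + ?S"
      unfolding quot \<rho>_eq by (rule fps_compose_X_times_binomial[OF u0 below[OF i]])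
    ultimately show ?thesis by (simp only: algebra_simps)
  qed
  have "A_act n \<rho> \<sigma> \<phi> i = \<phi> i + (if i = 0 then 0 else \<theta> i oo fps_inv \<rho>)" if i: "i \<le> n" for i
  proof (cases "i = 0")
    case True
    then show ?thesis
      using cancel[of "\<phi> 0"] by (simp add: A_act_def \<sigma>\<phi>[simplified] \<phi>0\<rho>)
  next
    case False
    \<comment> \<open>The left side is component i of \<sigma> after \<phi>; composing with the
      inverse of \<rho> turns the first summand on the right back into
      \<open>\<phi> i\<close>.\<close>
    then have "\<phi> i + H i = (\<phi> i oo \<rho>) + \<theta> i"
      using \<phi>\<rho>[of i] i by simp
    then show ?thesis
      using False \<sigma>\<phi>[OF i] by (simp add: A_act_def fps_compose_add_distrib cancel)
  qed
  then show ?thesis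
    using fps_initial_term_compose[OF inv0 inv1] by blast
qed

end
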